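(* Let $\mathcal{H}$ be a complex separable Hilbert space and let $T\subseteq\mathcal{H}\times\mathcal{H}$ be a super-idempotent linear relation. Put $\mathcal{M}:=\ker(I-T)$, $\mathcal{N}:=\ker T$ and $\mathcal{S}:=\operatorname{mul}T$. If $T$ admits a $2\times2$ block matrix representation with respect to $\overline{\mathcal{M}}$, then $$T=\begin{pmatrix} P_{\mathcal{M},\,\overline{\mathcal{M}}\cap\mathcal{N}} & x\,\hat{+}\,(\{0\}\times(\mathcal{S}\cap\overline{\mathcal{M}}))\\ 0\,\hat{+}\,(\{0\}\times(\mathcal{S}\cap\mathcal{M}^\perp)) & 0\end{pmatrix}_{\overline{\mathcal{M}}},$$ where $x=P_{\mathcal{M},\mathcal{N}}\cap(\mathcal{M}^\perp\times\mathcal{H})$, regarded as a linear relation from $\mathcal{M}^\perp$ to $\overline{\mathcal{M}}$.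
   Context: A linear relation from $\mathcal{H}$ to $\mathcal{K}$ is a linear subspace $T$ of $\mathcal{H}\times\mathcal{K}$; operators are identified with their graphs. $\ker T=\{x:(x,0)\in T\}$, $\operatorname{mul}T=\{y:(0,y)\in T\}$, $RT=\{(x,y): (x,z)\in T,\ (z,y)\in R\text{ for some }z\}$, $T^2=TT$, $I-T=\{(x,x-y):(x,y)\in T\}$, and $T\,\hat{+}\,S$ is the sum of $T$ and $S$ as subspaces of $\mathcal{H}\times\mathcal{K}$. $T\subseteq\mathcal{H}\times\mathcal{H}$ is super-idempotent if $T\subseteq T^2$. For subspaces $\mathcal{M},\mathcal{N}$ of $\mathcal{H}$ (not necessarily closed), $P_{\mathcal{M},\mathcal{N}}:=\{(m+n,m): m\in\mathcal{M},\ n\in\mathcal{N}\}$ is the multivalued projection with range $\mathcal{M}$ and kernel $\mathcal{N}$. The block $P_{\mathcal{M},\overline{\mathcal{M}}\cap\mathcal{N}}$ is regarded as a linear relation in $\overline{\mathcal{M}}\times\overline{\mathcal{M}}$. Block matrices: for a closed subspace $\mathcal{L}$ of $\mathcal{H}$ and linear relations $a$ from $\mathcal{L}$ to $\mathcal{L}$, $b$ from $\mathcal{L}^\perp$ to $\mathcal{L}$, $c$ from $\mathcal{L}$ to $\mathcal{L}^\perp$, $d$ from $\mathcal{L}^\perp$ to $\mathcal{L}^\perp$, $$\begin{pmatrix} a&b\\c&d\end{pmatrix}_{\mathcal{L}}:=\{(x_1+x_2,(w_1+z_1)+(w_2+z_2)):(x_1,w_1)\in a,\ (x_2,z_1)\in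 b,\ (x_1,w_2)\in c,\ (x_2,z_2)\in d\}.$$ A linear relation $T\subseteq\mathcal{H}\times\mathcal{H}$ admits a $2\times2$ block matrix representation with respect to $\mathcal{L}$ if there exist linear relations $a$ from $\mathcal{L}$ to $\mathcal{L}$, $b$ from $\mathcal{L}^\perp$ to $\mathcal{L}$, $c$ from $\mathcal{L}$ to $\mathcal{L}^\perp$ and $d$ from $\mathcal{L}^\perp$ to $\mathcal{L}^\perp$ with $T=\begin{pmatrix} a&b\\c&d\end{pmatrix}_{\mathcal{L}}$. In the matrix, $0$ denotes the everywhere defined zero operator between the corresponding subspaces. Equality is equality of linear relations. *)

theory Defs
  imports "HOL-Analysis.Analysis"
begin

class complex_vector = real_vector +
  fixes scaleC :: "complex \<Rightarrow> 'a \<Rightarrow> 'a"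
  assumes scaleC_add_right: "scaleC a (x + y) = scaleC a x + scaleC a y"
    and scaleC_add_left: "scaleC (a + b) x = scaleC a x + scaleC b x"
    and scaleC_scaleC: "scaleC a (scaleC b x) = scaleC (a * b) x"
    and scaleC_one: "scaleC 1 x = x"
    and scaleR_scaleC: "scaleR r x = scaleC (complex_of_real r) x"

interpretation complex_vector: vector_space "scaleC :: complex \<Rightarrow> 'a \<Rightarrow> 'a::complex_vector"
  by unfold_locales (simp_all add: scaleC_add_right scaleC_add_left scaleC_scaleC scaleC_one)

abbreviation csubspace :: "'a::complex_vector set \<Rightarrow> bool"
  where "csubspace \<equiv> complex_vector.subspace"

text \<open>The complex inner product is linear in its first argument. Its real part is the real inner
  product, so the norm is \<open>norm x = sqrt (Re (cinner x x))\<close>, and positive definiteness of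
  \<open>cinner\<close> is inherited from class \<open>real_inner\<close>.\<close>

class complex_inner = complex_vector + real_inner +
  fixes cinner :: "'a \<Rightarrow> 'a \<Rightarrow> complex"
  assumes cinner_commute: "cinner x y = cnj (cinner y x)"
    and cinner_add_left: "cinner (x + y) z = cinner x z + cinner y z"
    and cinner_scaleC_left: "cinner (scaleC c x) y = c * cinner x y"
    and inner_eq_Re_cinner: "inner x y = Re (cinner x y)"

class chilbert_space = complex_inner + complete_space

instantiation complex :: chilbert_space
begin
definition scaleC_complex :: "complex \<Rightarrow> complex \<Rightarrow> complex"
  where "scaleC_complex c x = c * x"
definition cinner_complex :: "complex \<Rightarrow> complex \<Rightarrow> complex"
  where "cinner_complex x y = x * cnj y"
instance
  by standard
    (simp_all add: scaleC_complex_def cinner_complex_def algebra_simps scaleR_conv_of_real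
      inner_complex_def)
end

instantiation prod :: (complex_vector, complex_vector) complex_vector
begin
definition scaleC_prod :: "complex \<Rightarrow> 'a \<times> 'b \<Rightarrow> 'a \<times> 'b"
  where "scaleC_prod c p = (scaleC c (fst p), scaleC c (snd p))"
instance
  by standard
    (simp_all add: scaleC_prod_def scaleC_add_right scaleC_add_left scaleC_scaleC scaleC_one
      scaleR_scaleC prod_eq_iff)
end

definition ortho_compl :: "'a::complex_inner set \<Rightarrow> 'a set"
  where "ortho_compl A = {x. \<forall>y\<in>A. cinner x y = 0}"

definition linear_relation ::
  "'a::complex_vector set \<Rightarrow> 'b::complex_vector set \<Rightarrow> ('a \<times> 'b) set \<Rightarrow> bool"
  where "linear_relation X Y T \<longleftrightarrow> csubspace T \<and> T \<subseteq> X \<times> Y"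

definition ker_rel :: "('a \<times> 'b::zero) set \<Rightarrow> 'a set"
  where "ker_rel T = {x. (x, 0) \<in> T}"

definition mul_rel :: "('a::zero \<times> 'b) set \<Rightarrow> 'b set"
  where "mul_rel T = {y. (0, y) \<in> T}"

definition id_minus :: "('a \<times> 'a::minus) set \<Rightarrow> ('a \<times> 'a) set"
  where "id_minus T = {(x, x - y) | x y. (x, y) \<in> T}"

text \<open>\<^term>\<open>T O R\<close> applies \<^term>\<open>T\<close> first, so it is the product \<open>RT\<close> of relations.
  The sum of two relations as subspaces of the product space is the elementwise sum \<open>+\<close> of sets of
  pairs.\<close>

definition super_idempotent :: "('a \<times> 'a) set \<Rightarrow> bool"
  where "super_idempotent T \<longleftrightarrow> T \<subseteq> T O T"

definition mproj :: "'a::plus set \<Rightarrow> 'a set \<Rightarrow> ('a \<times> 'a) set"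
  where "mproj M N = {(m + n, m) | m n. m \<in> M \<and> n \<in> N}"

definition zero_op :: "'a set \<Rightarrow> ('a \<times> 'b::zero) set"
  where "zero_op X = X \<times> {0}"

definition block_matrix ::
  "('a::plus \<times> 'a) set \<Rightarrow> ('a \<times> 'a) set \<Rightarrow> ('a \<times> 'a) set \<Rightarrow> ('a \<times> 'a) set \<Rightarrow> ('a \<times> 'a) set"
  where "block_matrix a b c d =
    {(x1 + x2, (w1 + z1) + (w2 + z2)) | x1 x2 w1 w2 z1 z2.
      (x1, w1) \<in> a \<and> (x2, z1) \<in> b \<and> (x1, w2) \<in> c \<and> (x2, z2) \<in> d}"

text \<open>The equation \<open>T = (a b; c d)\<close> with respect to \<open>L\<close>: the set-level matrix above does not
  mention \<open>L\<close>, which only enters through the subspaces the four entries have to act between.\<close>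

definition has_block_matrix ::
  "'a::complex_inner set \<Rightarrow> ('a \<times> 'a) set \<Rightarrow> ('a \<times> 'a) set \<Rightarrow> ('a \<times> 'a) set \<Rightarrow> ('a \<times> 'a) set
    \<Rightarrow> ('a \<times> 'a) set \<Rightarrow> bool"
  where "has_block_matrix L T a b c d \<longleftrightarrow>
    linear_relation L L a \<and>
    linear_relation (ortho_compl L) L b \<and>
    linear_relation L (ortho_compl L) c \<and>
    linear_relation (ortho_compl L) (ortho_compl L) d \<and>
    T = block_matrix a b c d"

definition admits_block_matrix :: "'a::complex_inner set \<Rightarrow> ('a \<times> 'a) set \<Rightarrow> bool"
  where "admits_block_matrix L T \<longleftrightarrow> (\<exists>a b c d. has_block_matrix L T a b c d)"

end

theory Submission
  imports Defs
begin

text \<open>If \<open>(x, y)\<close> and an intermediate \<open>z\<close> witness \<open>T \<subseteq> T\<^sup>2\<close>, then \<open>z \<in> M\<close>, \<open>x - z \<in> N\<close> and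
  \<open>y - z \<in> S\<close>; hence a super-idempotent relation consists exactly of the pairs \<open>(m + n, m + s)\<close>.
  A block representation splits every element of \<open>N\<close> into two components lying in the domain of
  \<open>T\<close>, and \<open>S\<close> into \<open>S \<inter> closure M\<close> and \<open>S \<inter> ortho_compl M\<close>. Decomposing the two components of
  \<open>n\<close> once more along \<open>M\<close> and \<open>N\<close> produces an error in \<open>M \<inter> N \<subseteq> S\<close>, which the multivalued parts
  of the off-diagonal entries absorb.\<close>

section \<open>Closures and orthogonal complements in complex inner product spaces\<close>

lemma cinner_scaleC_right:
  fixes x y :: "'a::complex_inner"
  shows "cinner x (scaleC c y) = cnj c * cinner x y"
  by (metis cinner_commute cinner_scaleC_left complex_cnj_mult)

lemma norm_scaleC:
  fixes x :: "'a::complex_inner"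
  shows "norm (scaleC c x) = cmod c * norm x"
proof -
  have "cinner (scaleC c x) (scaleC c x) = of_real ((cmod c)\<^sup>2) * cinner x x"
    by (simp add: cinner_scaleC_left cinner_scaleC_right complex_norm_square del: of_real_power)
  then have "(norm (scaleC c x))\<^sup>2 = (cmod c * norm x)\<^sup>2"
    by (simp add: power2_norm_eq_inner inner_eq_Re_cinner power_mult_distrib del: of_real_power)
  then show ?thesis
    by simp
qed

text \<open>Supplies continuity of complex scaling, so that scaling passes to closures.\<close>

lemma bounded_linear_scaleC:
  "bounded_linear (scaleC c :: 'a \<Rightarrow> 'a::complex_inner)"
  by (rule bounded_linear_intro[where K = "cmod c"])
    (simp_all add: scaleC_add_right scaleR_scaleC scaleC_scaleC norm_scaleC mult.commute)

lemma csubspace_closure: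
  fixes M :: "'a::complex_inner set"
  assumes "csubspace M"
  shows "csubspace (closure M)"
proof (rule complex_vector.subspaceI)
  show "0 \<in> closure M"
    using complex_vector.subspace_0[OF assms] closure_subset by blast
  show "x + y \<in> closure M" if "x \<in> closure M" "y \<in> closure M" for x y
  proof -
    \<comment> \<open>Set sums avoid limits: a sum of closures lies in the closure of the
      sum.\<close>
    have "M + M \<subseteq> M"
      using assms by (auto simp: set_plus_def intro: complex_vector.subspace_add)
    then have "closure M + closure M \<subseteq> closure M"
      using closure_sum closure_mono by (metis subset_trans)
    with that show ?thesis
      by blast
  qed
  show "scaleC c x \<in> closure M" if "x \<in> closure M" for c x
  proof -
    have "scaleC c ` closure M \<subseteq> closure M"
      by (rule image_closure_subset)
        (use assms closure_subset in \<open>auto intro: linear_continuous_on bounded_linear_scaleC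
          dest: complex_vector.subspace_scale\<close>)
    with that show ?thesis
      by blast
  qed
qed

lemma csubspace_ortho_compl:
  fixes M :: "'a::complex_inner set"
  shows "csubspace (ortho_compl M)"
proof -
  have "cinner 0 y = 0" for y :: 'a
    by (metis cinner_add_left add_cancel_left_left)
  then show ?thesis
    by (auto intro!: complex_vector.subspaceI
        simp: ortho_compl_def cinner_add_left cinner_scaleC_left)
qed

text \<open>Multiplying the first argument by \<open>\<i>\<close> moves the imaginary part, up to
  sign, into the real part. Complex orthogonality thus becomes two real equations, to which the
  continuity rules for \<open>inner\<close> apply.\<close>

lemma cinner_eq_0_iff:
  fixes x y :: "'a::complex_inner"
  shows "cinner x y = 0 \<longleftrightarrow> inner x y = 0 \<and> inner (scaleC \<i> x) y = 0"
  by (simp add: inner_eq_Re_cinner cinner_scaleC_left complex_eq_iff)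

lemma ortho_compl_closure:
  fixes M :: "'a::complex_inner set"
  shows "ortho_compl (closure M) = ortho_compl M"
proof
  show "ortho_compl (closure M) \<subseteq> ortho_compl M"
    using closure_subset by (auto simp: ortho_compl_def)
  show "ortho_compl M \<subseteq> ortho_compl (closure M)"
  proof
    fix x assume x: "x \<in> ortho_compl M"
    have "closed {y. cinner x y = 0}"
      unfolding cinner_eq_0_iff
      by (intro closed_Collect_conj closed_Collect_eq continuous_intros)
    moreover have "M \<subseteq> {y. cinner x y = 0}"
      using x by (auto simp: ortho_compl_def)
    ultimately have "closure M \<subseteq> {y. cinner x y = 0}"
      by (rule closure_minimal[rotated])
    then show "x \<in> ortho_compl (closure M)"
      by (auto simp: ortho_compl_def)
  qed
qed

lemma inter_ortho_compl_eq_0: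
  fixes x :: "'a::complex_inner"
  assumes "x \<in> L" "x \<in> ortho_compl L"
  shows "x = 0"
proof -
  have "cinner x x = 0"
    using assms by (simp add: ortho_compl_def)
  then show ?thesis
    by (simp add: cinner_eq_0_iff)
qed

section \<open>Subspaces of product spaces and linear relations\<close>

lemma scaleC_Pair:
  "scaleC c (x, y) = (scaleC c x, scaleC c y)"
  by (simp add: scaleC_prod_def)

lemma csubspace_set_plus:
  assumes "csubspace A" "csubspace B"
  shows "csubspace (A + B)"
proof -
  have "A + B = {x + y | x y. x \<in> A \<and> y \<in> B}"
    by (auto simp: set_plus_def)
  then show ?thesis
    using complex_vector.subspace_sums[OF assms] by simp
qed

lemma csubspace_Times:
  assumes "csubspace A" "csubspace B"
  shows "csubspace (A \<times> B)"
  using assms by (auto simp: complex_vector.subspace_def zero_prod_def scaleC_Pair)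

lemma csubspace_mproj:
  assumes "csubspace M" "csubspace N"
  shows "csubspace (mproj M N)"
proof (rule complex_vector.subspaceI)
  show "0 \<in> mproj M N"
    unfolding mproj_def zero_prod_def
    using complex_vector.subspace_0[OF assms(1)] complex_vector.subspace_0[OF assms(2)]
    by force
  show "p + q \<in> mproj M N" if "p \<in> mproj M N" "q \<in> mproj M N" for p q
  proof -
    obtain m n m' n' where "p = (m + n, m)" "q = (m' + n', m')"
      and mem: "m \<in> M" "n \<in> N" "m' \<in> M" "n' \<in> N"
      using \<open>p \<in> mproj M N\<close> \<open>q \<in> mproj M N\<close> by (auto simp: mproj_def)
    then have "p + q = ((m + m') + (n + n'), m + m')"
      by (simp add: algebra_simps)
    with mem assms show ?thesis
      unfolding mproj_def by (blast intro: complex_vector.subspace_add)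
  qed
  show "scaleC c p \<in> mproj M N" if "p \<in> mproj M N" for c p
  proof -
    obtain m n where "p = (m + n, m)" and mem: "m \<in> M" "n \<in> N"
      using \<open>p \<in> mproj M N\<close> by (auto simp: mproj_def)
    then have "scaleC c p = (scaleC c m + scaleC c n, scaleC c m)"
      by (simp add: scaleC_Pair scaleC_add_right)
    with mem assms show ?thesis
      unfolding mproj_def by (blast intro: complex_vector.subspace_scale)
  qed
qed

text \<open>With kernels of \<open>id_minus T\<close> read as fixed points, membership in M, N and S
  is in each case membership of a single pair in T.\<close>

lemma ker_id_minus:
  fixes T :: "('a::group_add \<times> 'a) set"
  shows "ker_rel (id_minus T) = {x. (x, x) \<in> T}"
  by (auto simp: ker_rel_def id_minus_def)

lemma pair_in_csubspace:
  fixes T :: "('a::complex_vector \<times> 'b::complex_vector) set"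
  assumes "csubspace T"
  shows "(x, y) \<in> T \<Longrightarrow> (x', y') \<in> T \<Longrightarrow> (x + x', y + y') \<in> T"
    and "(x, y) \<in> T \<Longrightarrow> (x', y') \<in> T \<Longrightarrow> (x - x', y - y') \<in> T"
    and "(x, y) \<in> T \<Longrightarrow> (scaleC c x, scaleC c y) \<in> T"
    and "(0, 0) \<in> T"
  using complex_vector.subspace_add[OF assms, of "(x, y)" "(x', y')"]
    complex_vector.subspace_diff[OF assms, of "(x, y)" "(x', y')"]
    complex_vector.subspace_scale[OF assms, of "(x, y)" c]
    complex_vector.subspace_0[OF assms]
  by (simp_all add: scaleC_Pair zero_prod_def)

lemma csubspace_fixed_ker_mul:
  assumes "csubspace T"
  shows "csubspace (ker_rel (id_minus T))" "csubspace (ker_rel T)" "csubspace (mul_rel T)"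
  using pair_in_csubspace[OF assms]
    \<comment> \<open>Fixing a component at 0 lets its sums and multiples collapse to 0, as the
      kernel and the multivalued part require.\<close>
    pair_in_csubspace(1)[OF assms, of _ 0 _ 0] pair_in_csubspace(3)[OF assms, of _ 0]
    pair_in_csubspace(1)[OF assms, of 0 _ 0] pair_in_csubspace(3)[OF assms, of 0]
  by (auto intro!: complex_vector.subspaceI simp: ker_id_minus) (auto simp: ker_rel_def mul_rel_def)

section \<open>Decompositions from super-idempotence and from a block representation\<close>

lemma super_idempotent_decomp:
  assumes "csubspace T" "super_idempotent T" "(x, y) \<in> T"
  obtains m n where "(m, m) \<in> T" "(n, 0) \<in> T" "(0, y - m) \<in> T" "x = m + n"
proof -
  note T = pair_in_csubspace[OF assms(1)]
  obtain z where z: "(x, z) \<in> T" "(z, y) \<in> T"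
    using assms(2,3) by (auto simp: super_idempotent_def)
  \<comment> \<open>Pairs with the same first component differ by a pair over 0. Removing that pair
    from \<open>(z, y)\<close> makes z a fixed point, and removing \<open>(z, z)\<close> from
    \<open>(x, z)\<close> leaves a kernel element.\<close>
  have mul: "(0, y - z) \<in> T"
    using T(2)[OF assms(3) z(1)] by simp
  have fix_z: "(z, z) \<in> T"
    using T(2)[OF z(2) mul] by simp
  have "(x - z, 0) \<in> T"
    using T(2)[OF z(1) fix_z] by simp
  with fix_z mul show thesis
    by (intro that[of z "x - z"]) simp_all
qed

text \<open>Every entry contains \<open>(0, 0)\<close>, so either column can be switched off while
  the other still yields a pair of T. What matters later is that both components lie in the domain;
  their values stay unspecified.\<close>

lemma has_block_matrix_domain_split:
  assumes "has_block_matrix L T a b c d" "(x, y) \<in> T"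
  obtains x1 x2 y1 y2 where "x = x1 + x2" "x1 \<in> L" "x2 \<in> ortho_compl L"
    "(x1, y1) \<in> T" "(x2, y2) \<in> T"
proof -
  have T: "T = block_matrix a b c d"
    and sub: "a \<subseteq> L \<times> L" "b \<subseteq> ortho_compl L \<times> L"
    and zero: "(0, 0) \<in> a" "(0, 0) \<in> b" "(0, 0) \<in> c" "(0, 0) \<in> d"
    using assms(1) pair_in_csubspace(4)
    by (auto simp: has_block_matrix_def linear_relation_def)
  obtain x1 x2 w1 w2 z1 z2 where x: "x = x1 + x2"
    and mem: "(x1, w1) \<in> a" "(x2, z1) \<in> b" "(x1, w2) \<in> c" "(x2, z2) \<in> d"
    using assms(2) unfolding T block_matrix_def by auto
  have "(x1 + 0, (w1 + 0) + (w2 + 0)) \<in> T" "(0 + x2, (0 + z1) + (0 + z2)) \<in> T"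
    unfolding T block_matrix_def using mem zero by blast+
  moreover have "x1 \<in> L" "x2 \<in> ortho_compl L"
    using mem sub by auto
  ultimately show thesis
    using x by (intro that[of x1 x2]) auto
qed

text \<open>Over 0 both inputs vanish, because L meets its complement only in 0. Each row can then
  be switched off separately, and the row values lie in L and in its complement.\<close>

lemma has_block_matrix_mul_split:
  assumes "has_block_matrix L T a b c d" "csubspace L" "s \<in> mul_rel T"
  obtains s1 s2 where "s = s1 + s2" "s1 \<in> mul_rel T \<inter> L" "s2 \<in> mul_rel T \<inter> ortho_compl L"
proof -
  have T: "T = block_matrix a b c d"
    and sub: "a \<subseteq> L \<times> L" "b \<subseteq> ortho_compl L \<times> L" "c \<subseteq> L \<times> ortho_compl L"
      "d \<subseteq> ortho_compl L \<times> ortho_compl L"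
    and zero: "(0, 0) \<in> a" "(0, 0) \<in> b" "(0, 0) \<in> c" "(0, 0) \<in> d"
    using assms(1) pair_in_csubspace(4)
    by (auto simp: has_block_matrix_def linear_relation_def)
  obtain x1 x2 w1 w2 z1 z2 where x: "0 = x1 + x2" and s: "s = (w1 + z1) + (w2 + z2)"
    and mem: "(x1, w1) \<in> a" "(x2, z1) \<in> b" "(x1, w2) \<in> c" "(x2, z2) \<in> d"
    using assms(3) unfolding T block_matrix_def mul_rel_def by auto
  have "x1 \<in> L" "x2 \<in> ortho_compl L"
    using mem sub by auto
  moreover have "x1 = - x2"
    using x by (simp add: eq_neg_iff_add_eq_0)
  ultimately have "x1 = 0"
    using csubspace_ortho_compl[of L]
    by (metis complex_vector.subspace_neg inter_ortho_compl_eq_0)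
  with x have "x2 = 0"
    by simp
  note mem0 = mem[unfolded \<open>x1 = 0\<close> \<open>x2 = 0\<close>]
  have "(0 + 0, (w1 + z1) + (0 + 0)) \<in> T" "(0 + 0, (0 + 0) + (w2 + z2)) \<in> T"
    unfolding T block_matrix_def using mem0 zero by blast+
  moreover have "w1 + z1 \<in> L" "w2 + z2 \<in> ortho_compl L"
    using mem sub assms(2) csubspace_ortho_compl[of L]
    by (auto intro: complex_vector.subspace_add)
  ultimately show thesis
    using s by (intro that[of "w1 + z1" "w2 + z2"]) (auto simp: mul_rel_def)
qed

section \<open>Identification of the four blocks\<close>

theorem proposition3p16:
  fixes T :: "('h::chilbert_space \<times> 'h) set" and M N S :: "'h set"
  assumes "separable_space (euclidean :: 'h topology)"
    and "linear_relation UNIV UNIV T"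
    and "super_idempotent T"
    and "M = ker_rel (id_minus T)"
    and "N = ker_rel T"
    and "S = mul_rel T"
    and "admits_block_matrix (closure M) T"
  shows "has_block_matrix (closure M) T
    (mproj M (closure M \<inter> N))
    ((mproj M N \<inter> (ortho_compl M \<times> UNIV)) + {0} \<times> (S \<inter> closure M))
    (zero_op (closure M) + {0} \<times> (S \<inter> ortho_compl M))
    (zero_op (ortho_compl (closure M)))"
proof -
  have csT: "csubspace T"
    using assms(2) by (simp add: linear_relation_def)
  note T = pair_in_csubspace[OF csT]
  have M_iff: "m \<in> M \<longleftrightarrow> (m, m) \<in> T" and N_iff: "m \<in> N \<longleftrightarrow> (m, 0) \<in> T"
    and S_iff: "m \<in> S \<longleftrightarrow> (0, m) \<in> T" for m
    using assms(4-6) by (auto simp: ker_id_minus) (auto simp: ker_rel_def mul_rel_def)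
  have csM: "csubspace M" and csN: "csubspace N" and csS: "csubspace S"
    using csubspace_fixed_ker_mul[OF csT] assms(4-6) by auto
  define L where "L = closure M"
  have csL: "csubspace L" and M_le: "M \<subseteq> L" and LM: "ortho_compl L = ortho_compl M"
    using csM closure_subset by (auto simp: L_def csubspace_closure ortho_compl_closure)
  have csLo: "csubspace (ortho_compl M)"
    by (rule csubspace_ortho_compl)
  obtain a b c d where block: "has_block_matrix L T a b c d"
    using assms(7) by (auto simp: admits_block_matrix_def L_def)
  define A where "A = mproj M (L \<inter> N)"
  define B where "B = (mproj M N \<inter> (ortho_compl M \<times> UNIV)) + {0} \<times> (S \<inter> L)"
  define C where "C = zero_op L + {0} \<times> (S \<inter> ortho_compl M)"
  define D where "D = (zero_op (ortho_compl L) :: ('h \<times> 'h) set)"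
  have A_iff: "p \<in> A \<longleftrightarrow> (\<exists>m n. p = (m + n, m) \<and> m \<in> M \<and> n \<in> L \<and> n \<in> N)" for p
    by (auto simp: A_def mproj_def)
  have B_iff: "p \<in> B \<longleftrightarrow>
      (\<exists>m n s. p = (m + n, m + s) \<and> m \<in> M \<and> n \<in> N \<and> m + n \<in> ortho_compl M \<and> s \<in> S \<and> s \<in> L)"
    for p
    unfolding B_def mproj_def set_plus_def by force
  have C_iff: "p \<in> C \<longleftrightarrow> fst p \<in> L \<and> snd p \<in> S \<and> snd p \<in> ortho_compl M" for p
    unfolding C_def zero_op_def set_plus_def by force
  have D_iff: "p \<in> D \<longleftrightarrow> fst p \<in> ortho_compl M \<and> snd p = 0" for p
    by (cases p) (auto simp: D_def zero_op_def LM)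
  have single0: "csubspace {0::'h}"
    by (rule complex_vector.subspace_single_0)
  have "linear_relation L L A"
    unfolding linear_relation_def
  proof
    show "csubspace A"
      unfolding A_def by (intro csubspace_mproj complex_vector.subspace_inter csM csL csN)
    show "A \<subseteq> L \<times> L"
      by (auto simp: A_iff complex_vector.subspace_add[OF csL] subsetD[OF M_le])
  qed
  moreover have "linear_relation (ortho_compl L) L B"
    unfolding linear_relation_def
  proof
    show "csubspace B"
      unfolding B_def
      by (intro csubspace_set_plus csubspace_Times csubspace_mproj complex_vector.subspace_inter
          complex_vector.subspace_UNIV csM csL csN csS csLo single0)
    show "B \<subseteq> ortho_compl L \<times> L"
      by (auto simp: B_iff LM complex_vector.subspace_add[OF csL] subsetD[OF M_le])
  qed
  moreover have "linear_relation L (ortho_compl L) C"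
    unfolding linear_relation_def
  proof
    show "csubspace C"
      unfolding C_def zero_op_def
      by (intro csubspace_set_plus csubspace_Times complex_vector.subspace_inter
          csL csS csLo single0)
    show "C \<subseteq> L \<times> ortho_compl L"
      by (auto simp: C_iff LM)
  qed
  moreover have "linear_relation (ortho_compl L) (ortho_compl L) D"
    unfolding linear_relation_def
  proof
    show "csubspace D"
      unfolding D_def zero_op_def LM by (intro csubspace_Times csLo single0)
    show "D \<subseteq> ortho_compl L \<times> ortho_compl L"
      using complex_vector.subspace_0[OF csLo] by (auto simp: D_iff LM)
  qed
  moreover have "T = block_matrix A B C D"
  proof (intro equalityI subsetI)
    fix p assume "p \<in> T"
    then obtain x y where p: "p = (x, y)" and xy: "(x, y) \<in> T"
      by (cases p) auto
    obtain m n where m: "m \<in> M" and n: "n \<in> N" and s: "y - m \<in> S" and x: "x = m + n"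
      using super_idempotent_decomp[OF csT assms(3) xy] M_iff N_iff S_iff by metis
    obtain n1 n2 y1 y2 where n12: "n = n1 + n2" and n1: "n1 \<in> L" and n2: "n2 \<in> ortho_compl M"
      and T12: "(n1, y1) \<in> T" "(n2, y2) \<in> T"
      using has_block_matrix_domain_split[OF block] n LM N_iff by metis
    \<comment> \<open>The components of n lie in the domain of T but need not lie in N, so
      super-idempotence is applied to each of them.\<close>
    obtain m1 k1 where mk1: "m1 \<in> M" "k1 \<in> N" "n1 = m1 + k1"
      using super_idempotent_decomp[OF csT assms(3) T12(1)] M_iff N_iff by metis
    obtain m2 k2 where mk2: "m2 \<in> M" "k2 \<in> N" "n2 = m2 + k2"
      using super_idempotent_decomp[OF csT assms(3) T12(2)] M_iff N_iff by metis
    have "m1 + m2 = n - (k1 + k2)"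
      using n12 mk1 mk2 by simp
    then have "m1 + m2 \<in> N"
      using n mk1 mk2 csN by (simp add: complex_vector.subspace_add complex_vector.subspace_diff)
    moreover have "m1 + m2 \<in> M"
      using mk1 mk2 csM by (simp add: complex_vector.subspace_add)
    \<comment> \<open>For e in both M and N, \<open>(e, e) - (e, 0) = (0, e)\<close>.\<close>
    ultimately have "m1 + m2 \<in> S"
      using T(2)[of "m1 + m2" "m1 + m2" "m1 + m2" 0] by (simp add: M_iff N_iff S_iff)
    \<comment> \<open>The blocks will output \<open>m + m1\<close> and \<open>m2\<close>; this is
      what remains of y. It splits into \<open>s1\<close> for the upper right block and
      \<open>s2\<close> for the lower left one.\<close>
    with csS s have "(y - m) - (m1 + m2) \<in> S"
      by (rule complex_vector.subspace_diff)
    then obtain s1 s2 where s12: "(y - m) - (m1 + m2) = s1 + s2"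
      and s1: "s1 \<in> S \<inter> L" and s2: "s2 \<in> S \<inter> ortho_compl M"
      using has_block_matrix_mul_split[OF block csL] assms(6) LM by metis
    \<comment> \<open>The upper left block admits only kernel elements in L.\<close>
    have "n1 - m1 \<in> L"
      using complex_vector.subspace_diff[OF csL n1 subsetD[OF M_le mk1(1)]] .
    then have k1: "k1 \<in> L"
      using mk1 by simp
    have "(m + n1, m + m1) \<in> A"
      unfolding A_iff
      by (intro exI[of _ "m + m1"] exI[of _ k1])
        (use m mk1 k1 csM in \<open>auto simp: complex_vector.subspace_add algebra_simps\<close>)
    moreover have "(n2, m2 + s1) \<in> B"
      unfolding B_iff using mk2 n2 s1 by auto
    moreover have "(m + n1, s2) \<in> C"
      using m n1 s2 by (simp add: C_iff complex_vector.subspace_add[OF csL] subsetD[OF M_le])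
    moreover have "(n2, 0) \<in> D"
      using n2 by (simp add: D_iff)
    moreover have "x = (m + n1) + n2" "y = ((m + m1) + (m2 + s1)) + (s2 + 0)"
      using x n12 s12 by (simp_all add: algebra_simps)
    ultimately show "p \<in> block_matrix A B C D"
      unfolding p block_matrix_def by blast
  next
    \<comment> \<open>Conversely, pairs of A and B already belong to T: they are sums of
      \<open>(m, m)\<close>, \<open>(n, 0)\<close> and, for B, \<open>(0, s)\<close>. C adds only
      some \<open>(0, w2)\<close> with \<open>w2\<close> in S, and D adds the value 0.\<close>
    fix p assume "p \<in> block_matrix A B C D"
    then obtain x1 x2 w1 w2 z1 where p: "p = (x1 + x2, (w1 + z1) + w2)"
      and mem: "(x1, w1) \<in> A" "(x2, z1) \<in> B" "w2 \<in> S"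
      by (auto simp: block_matrix_def C_iff D_iff)
    have "(x1, w1) \<in> T"
      using mem(1) T(1)[of _ _ _ 0] by (auto simp: A_iff M_iff N_iff)
    moreover have "(x2, z1) \<in> T"
    proof -
      obtain m n s where "x2 = m + n" "z1 = m + s" "(m, m) \<in> T" "(n, 0) \<in> T" "(0, s) \<in> T"
        using mem(2) by (auto simp: B_iff M_iff N_iff S_iff)
      then show ?thesis
        using T(1)[OF T(1)[of m m n 0], of 0 s] by simp
    qed
    ultimately have "(x1 + x2, w1 + z1) \<in> T"
      by (rule T(1))
    from T(1)[OF this, of 0 w2] mem(3) show "p \<in> T"
      by (simp add: p S_iff)
  qed
  ultimately show ?thesis
    unfolding has_block_matrix_def A_def B_def C_def D_def L_def by blast
qed

end
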